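(* Let $\hat A\in\mathbb{R}^{r\times(m-r)}$ have full row rank $r\le m-r$, let $L\in\mathbb{R}^{r\times r}$ be symmetric positive semi-definite, and let $g\in\operatorname{Im}(L)\subset\mathbb{R}^r$. Let $\hat X,\tilde X,\Lambda_p$ be as in the eigendecomposition given in the context. For $u^{n_+}\in\mathbb{R}^r$ and $u^{n_-}\in\mathbb{R}^{m-r}$ define the outgoing and incoming characteristic variables $w_+,w_-\in\mathbb{R}^r$ by $$\begin{pmatrix}w_+\\ w_-\end{pmatrix}=\frac1{\sqrt2}\begin{pmatrix}\hat X^T&\tilde X^T\\ \hat X^T&-\tilde X^T\end{pmatrix}\begin{pmatrix}u^{n_+}\\ u^{n_-}\end{pmatrix}.$$ Then the Onsager boundary condition $$u^{n_+}=L\hat A\,u^{n_-}+g$$ is equivalent to $$(L\hat X\Lambda_p+\hat X)\,w_-=(L\hat X\Lambda_p-\hat X)\,w_++\sqrt2\,g .$$ Moreover the matrix $L\hat X\Lambda_p+\hat X$ is invertible; therefore the Onsager boundary condition uniquely determines the incoming characteristic variables $w_-$ by the outgoing ones $w_+$ and the boundary data $g$.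
   Context: Setting: at a boundary point with outward unit normal $n$, the directional transport matrix of a hyperbolic system, expressed in the variables $(u^{n_+},u^{n_-})$, is $A=\begin{pmatrix}0&\hat A\\ \hat A^T&0\end{pmatrix}\in\mathbb{R}^{m\times m}$. It has an eigendecomposition $A=X\Lambda X^T$ with $$X=\frac1{\sqrt2}\begin{pmatrix}\hat X&0&\hat X\\ \tilde X&\sqrt2X^k&-\tilde X\end{pmatrix},\qquad\Lambda=\operatorname{diag}(\Lambda_p,0,-\Lambda_p),$$ where $\Lambda_p\in\mathbb{R}^{r\times r}$ is diagonal positive definite, $\hat X\in\mathbb{R}^{r\times r}$ is orthogonal, $\tilde X\in\mathbb{R}^{(m-r)\times r}$ has orthonormal columns, and the columns of $X^k\in\mathbb{R}^{(m-r)\times(m-2r)}$ form an orthonormal basis of $\ker\hat A$ and are orthogonal to the columns of $\tilde X$; in particular $\hat A=\hat X\Lambda_p\tilde X^T$. The variables $w_+$ belong to the positive eigenvalues (outgoing waves) and $w_-$ to the negative eigenvalues (incoming waves). *)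

theory Defs
  imports
    Complex_Main
    "Jordan_Normal_Form.Matrix_Kernel"
    "Jordan_Normal_Form.DL_Rank"
begin

text \<open>
  Matrices with explicit dimensions are used because the block of zero eigenvalues has
  size \<open>m - 2 * r\<close>, which may be \<open>0\<close>.
\<close>

definition symmetric_mat :: "real mat \<Rightarrow> bool" where
  "symmetric_mat M \<longleftrightarrow> square_mat M \<and> M\<^sup>T = M"

definition pos_semidef :: "real mat \<Rightarrow> bool" where
  "pos_semidef M \<longleftrightarrow> square_mat M \<and> (\<forall>v \<in> carrier_vec (dim_row M). 0 \<le> v \<bullet> (M *\<^sub>v v))"

definition pos_def :: "real mat \<Rightarrow> bool" where
  "pos_def M \<longleftrightarrow> square_mat M \<and>
     (\<forall>v \<in> carrier_vec (dim_row M). v \<noteq> 0\<^sub>v (dim_row M) \<longrightarrow> 0 < v \<bullet> (M *\<^sub>v v))"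

text \<open>
  The library predicate \<open>orthogonal_mat\<close> only asks for pairwise orthogonal nonzero columns;
  here the columns are normalised. A square matrix with this property is an orthogonal matrix.
\<close>

definition orthonormal_cols :: "real mat \<Rightarrow> bool" where
  "orthonormal_cols M \<longleftrightarrow> M\<^sup>T * M = 1\<^sub>m (dim_col M)"

definition append_cols :: "'a :: zero mat \<Rightarrow> 'a mat \<Rightarrow> 'a mat" (infixr \<open>@\<^sub>c\<close> 66) where
  "A @\<^sub>c B = four_block_mat A B (0\<^sub>m 0 (dim_col A)) (0\<^sub>m 0 (dim_col B))"

definition transport_mat :: "nat \<Rightarrow> nat \<Rightarrow> real mat \<Rightarrow> real mat" where
  "transport_mat m r Ah = four_block_mat (0\<^sub>m r r) Ah (Ah\<^sup>T) (0\<^sub>m (m - r) (m - r))"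

definition eigvec_mat :: "nat \<Rightarrow> nat \<Rightarrow> real mat \<Rightarrow> real mat \<Rightarrow> real mat \<Rightarrow> real mat" where
  "eigvec_mat m r Xh Xt Xk =
     (1 / sqrt 2) \<cdot>\<^sub>m ((Xh @\<^sub>c 0\<^sub>m r (m - 2 * r) @\<^sub>c Xh) @\<^sub>r (Xt @\<^sub>c (sqrt 2 \<cdot>\<^sub>m Xk) @\<^sub>c (- Xt)))"

definition eigval_mat :: "nat \<Rightarrow> nat \<Rightarrow> real mat \<Rightarrow> real mat" where
  "eigval_mat m r Lp = diag_block_mat [Lp, 0\<^sub>m (m - 2 * r) (m - 2 * r), - Lp]"

definition is_eigendecomposition ::
  "nat \<Rightarrow> nat \<Rightarrow> real mat \<Rightarrow> real mat \<Rightarrow> real mat \<Rightarrow> real mat \<Rightarrow> real mat \<Rightarrow> bool" where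
  "is_eigendecomposition m r Ah Xh Xt Xk Lp \<longleftrightarrow>
     Lp \<in> carrier_mat r r \<and> diagonal_mat Lp \<and> pos_def Lp \<and>
     Xh \<in> carrier_mat r r \<and> orthonormal_cols Xh \<and>
     Xt \<in> carrier_mat (m - r) r \<and> orthonormal_cols Xt \<and>
     Xk \<in> carrier_mat (m - r) (m - 2 * r) \<and> orthonormal_cols Xk \<and>
     kernel.basis (m - r) Ah (set (cols Xk)) \<and>
     (\<forall>x \<in> set (cols Xk). \<forall>y \<in> set (cols Xt). x \<bullet> y = 0) \<and>
     transport_mat m r Ah =
       eigvec_mat m r Xh Xt Xk * eigval_mat m r Lp * (eigvec_mat m r Xh Xt Xk)\<^sup>T"

text \<open>
  The stacked vector of the outgoing variables (first \<open>r\<close> entries) and the incoming variables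
  (last \<open>r\<close> entries).
\<close>

definition characteristic_vars ::
  "real mat \<Rightarrow> real mat \<Rightarrow> real vec \<Rightarrow> real vec \<Rightarrow> real vec" where
  "characteristic_vars Xh Xt up um =
     (1 / sqrt 2) \<cdot>\<^sub>v (four_block_mat (Xh\<^sup>T) (Xt\<^sup>T) (Xh\<^sup>T) (- (Xt\<^sup>T)) *\<^sub>v (up @\<^sub>v um))"

definition onsager_bc ::
  "real mat \<Rightarrow> real mat \<Rightarrow> real vec \<Rightarrow> real vec \<Rightarrow> real vec \<Rightarrow> bool" where
  "onsager_bc L Ah g up um \<longleftrightarrow> up = (L * Ah) *\<^sub>v um + g"

end

theory Submission
  imports Defs
begin

text \<open>
  The upper right block of \<open>A = X \<Lambda> X\<^sup>T\<close> gives \<open>Ah = Xh Lp Xt\<^sup>T\<close>. Since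
  \<open>w\<^sub>+ + w\<^sub>- = \<surd>2 Xh\<^sup>T u\<^sub>+\<close> and \<open>w\<^sub>+ - w\<^sub>- = \<surd>2 Xt\<^sup>T u\<^sub>-\<close>, multiplying the boundary
  condition by \<open>\<surd>2\<close> yields its characteristic form. If \<open>(L Xh Lp + Xh) v = 0\<close> and
  \<open>w = Xh Lp v\<close>, then \<open>0 \<le> w \<bullet> L w = - (w \<bullet> Xh v) = - (v \<bullet> Lp v)\<close>, so \<open>v = 0\<close>.
\<close>

section \<open>Rows of block matrices\<close>

lemma append_cols_carrier:
  assumes "A \<in> carrier_mat nr n1" "B \<in> carrier_mat nr n2"
  shows "A @\<^sub>c B \<in> carrier_mat nr (n1 + n2)"
  using assms unfolding append_cols_def by auto

lemma row_append_cols: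
  assumes "A \<in> carrier_mat nr n1" "B \<in> carrier_mat nr n2" "i < nr"
  shows "row (A @\<^sub>c B) i = row A i @\<^sub>v row B i"
  using assms unfolding append_cols_def
  by (intro row_four_block_mat(1)[where ?nr2.0 = 0]) auto

lemma row_append_rows:
  assumes "A \<in> carrier_mat n1 nc" "B \<in> carrier_mat n2 nc" "i < n1 + n2"
  shows "row (A @\<^sub>r B) i = (if i < n1 then row A i else row B (i - n1))"
  using assms unfolding append_rows_def by (intro eq_vecI) auto

lemma smult_append_vec:
  "a \<cdot>\<^sub>v (v @\<^sub>v w) = (a \<cdot>\<^sub>v v) @\<^sub>v (a \<cdot>\<^sub>v (w :: 'a :: semiring_0 vec))"
  by (intro eq_vecI) auto

section \<open>Orthonormal columns and invertible matrices\<close>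

lemma orthonormal_cols_mult_vec:
  assumes "orthonormal_cols M" "M \<in> carrier_mat n k" "v \<in> carrier_vec k"
  shows "M\<^sup>T *\<^sub>v (M *\<^sub>v v) = v"
  using assms assoc_mult_mat_vec[of "M\<^sup>T" k n M k v] by (simp add: orthonormal_cols_def)

text \<open>For a square matrix the left inverse \<open>M\<^sup>T\<close> is also a right inverse.
  For a matrix with more rows than columns, \<open>M * M\<^sup>T\<close> would only be a
  projection.\<close>

lemma orthonormal_cols_square_mult_vec:
  assumes "orthonormal_cols M" "M \<in> carrier_mat n n" "v \<in> carrier_vec n"
  shows "M *\<^sub>v (M\<^sup>T *\<^sub>v v) = v"
proof -
  have "M * M\<^sup>T = 1\<^sub>m n"
    by (rule mat_mult_left_right_inverse) (use assms in \<open>auto simp: orthonormal_cols_def\<close>)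
  then show ?thesis using assms assoc_mult_mat_vec[of M n n "M\<^sup>T" n v] by simp
qed

text \<open>A trivial kernel forces a nonzero determinant, which over a field makes the matrix a
  unit of the matrix ring.\<close>

lemma invertible_matI_kernel:
  fixes A :: "'a :: field mat"
  assumes A: "A \<in> carrier_mat n n"
    and ker: "\<And>v. v \<in> carrier_vec n \<Longrightarrow> A *\<^sub>v v = 0\<^sub>v n \<Longrightarrow> v = 0\<^sub>v n"
  shows "invertible_mat A"
proof -
  have "det A \<noteq> 0" using ker det_0_iff_vec_prod_zero[OF A] by blast
  then obtain B where "B \<in> carrier_mat n n" "A * B = 1\<^sub>m n" "B * A = 1\<^sub>m n"
    using det_non_zero_imp_unit[OF A, of "()"] by (auto simp: Units_def ring_mat_def)
  then show ?thesis using A unfolding invertible_mat_def inverts_mat_def by auto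
qed

lemma invertible_mat_ex1:
  fixes A :: "'a :: comm_ring_1 mat"
  assumes A: "A \<in> carrier_mat n n" and inv: "invertible_mat A" and b: "b \<in> carrier_vec n"
  shows "\<exists>!v. v \<in> carrier_vec n \<and> A *\<^sub>v v = b"
proof -
  obtain B where AB: "A * B = 1\<^sub>m (dim_row A)" and BA: "B * A = 1\<^sub>m (dim_row B)"
    using inv unfolding invertible_mat_def inverts_mat_def by blast
  \<comment> \<open>\<open>inverts_mat\<close> leaves the shape of \<open>B\<close> open; comparing
    the column counts in the two product equations fixes both dimensions.\<close>
  have B: "B \<in> carrier_mat n n"
    using A arg_cong[OF AB, of dim_col] arg_cong[OF BA, of dim_col] by auto
  show ?thesis
  proof (rule ex1I[of _ "B *\<^sub>v b"])
    have "A *\<^sub>v (B *\<^sub>v b) = (A * B) *\<^sub>v b"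
      by (rule assoc_mult_mat_vec[OF A B b, symmetric])
    then show "B *\<^sub>v b \<in> carrier_vec n \<and> A *\<^sub>v (B *\<^sub>v b) = b"
      using A B b AB by simp
    fix v assume v: "v \<in> carrier_vec n \<and> A *\<^sub>v v = b"
    then have "B *\<^sub>v b = (B * A) *\<^sub>v v" using assoc_mult_mat_vec[OF B A, of v] by simp
    then show "v = B *\<^sub>v b" using BA B v by simp
  qed
qed

section \<open>The upper right block of the eigendecomposition\<close>

text \<open>An entry of \<open>X * E * X\<^sup>T\<close> pairs one row of \<open>X\<close> with
  \<open>E\<close> applied to another, so rows are the convenient description of the eigenvector
  matrix. Dimensions stay sums such as \<open>r + (m - r)\<close>, which follow the blocks and avoid
  resolving truncated subtraction.\<close>

lemma row_eigvec_mat: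
  assumes Xh: "Xh \<in> carrier_mat r r" and Xt: "Xt \<in> carrier_mat (m - r) r"
    and Xk: "Xk \<in> carrier_mat (m - r) (m - 2 * r)"
  shows "i < r \<Longrightarrow> row (eigvec_mat m r Xh Xt Xk) i =
           (1 / sqrt 2) \<cdot>\<^sub>v (row Xh i @\<^sub>v 0\<^sub>v (m - 2 * r) @\<^sub>v row Xh i)"
    and "j < m - r \<Longrightarrow> row (eigvec_mat m r Xh Xt Xk) (r + j) =
           (1 / sqrt 2) \<cdot>\<^sub>v (row Xt j @\<^sub>v (sqrt 2 \<cdot>\<^sub>v row Xk j) @\<^sub>v - row Xt j)"
    and "eigvec_mat m r Xh Xt Xk \<in> carrier_mat (r + (m - r)) (r + (m - 2 * r + r))"
proof -
  let ?Z = "0\<^sub>m r (m - 2 * r) @\<^sub>c Xh" and ?Y = "(sqrt 2 \<cdot>\<^sub>m Xk) @\<^sub>c (- Xt)"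
  have Z: "?Z \<in> carrier_mat r (m - 2 * r + r)"
    using Xh by (intro append_cols_carrier) auto
  have Y: "?Y \<in> carrier_mat (m - r) (m - 2 * r + r)"
    using Xt Xk by (intro append_cols_carrier) auto
  have U: "Xh @\<^sub>c ?Z \<in> carrier_mat r (r + (m - 2 * r + r))"
    by (intro append_cols_carrier Xh Z)
  have D: "Xt @\<^sub>c ?Y \<in> carrier_mat (m - r) (r + (m - 2 * r + r))"
    by (intro append_cols_carrier Xt Y)
  have UD: "(Xh @\<^sub>c ?Z) @\<^sub>r (Xt @\<^sub>c ?Y) \<in> carrier_mat (r + (m - r)) (r + (m - 2 * r + r))"
    by (rule carrier_append_rows[OF U D])
  then show "eigvec_mat m r Xh Xt Xk \<in> carrier_mat (r + (m - r)) (r + (m - 2 * r + r))"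
    unfolding eigvec_mat_def by simp
  have row_smult: "row (a \<cdot>\<^sub>m M) i = a \<cdot>\<^sub>v row M i" if "i < dim_row M" for a :: real and M i
    using that by (intro eq_vecI) auto
  show "row (eigvec_mat m r Xh Xt Xk) i =
      (1 / sqrt 2) \<cdot>\<^sub>v (row Xh i @\<^sub>v 0\<^sub>v (m - 2 * r) @\<^sub>v row Xh i)" if i: "i < r"
  proof -
    have "row ?Z i = 0\<^sub>v (m - 2 * r) @\<^sub>v row Xh i"
      using i Xh by (subst row_append_cols[of _ r "m - 2 * r" _ r]) auto
    then have "row (Xh @\<^sub>c ?Z) i = row Xh i @\<^sub>v 0\<^sub>v (m - 2 * r) @\<^sub>v row Xh i"
      by (simp add: row_append_cols[OF Xh Z i])
    moreover have "row ((Xh @\<^sub>c ?Z) @\<^sub>r (Xt @\<^sub>c ?Y)) i = row (Xh @\<^sub>c ?Z) i"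
      using i by (subst row_append_rows[OF U D]) auto
    ultimately show ?thesis
      unfolding eigvec_mat_def using i UD by (subst row_smult) auto
  qed
  show "row (eigvec_mat m r Xh Xt Xk) (r + j) =
      (1 / sqrt 2) \<cdot>\<^sub>v (row Xt j @\<^sub>v (sqrt 2 \<cdot>\<^sub>v row Xk j) @\<^sub>v - row Xt j)" if j: "j < m - r"
  proof -
    have "row (- Xt) j = - row Xt j" using j Xt by (intro eq_vecI) auto
    then have "row ?Y j = (sqrt 2 \<cdot>\<^sub>v row Xk j) @\<^sub>v - row Xt j"
      using j Xt Xk by (subst row_append_cols[of _ "m - r" "m - 2 * r" _ r]) (auto simp: row_smult)
    then have "row (Xt @\<^sub>c ?Y) j = row Xt j @\<^sub>v (sqrt 2 \<cdot>\<^sub>v row Xk j) @\<^sub>v - row Xt j"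
      by (simp add: row_append_cols[OF Xt Y j])
    moreover have "row ((Xh @\<^sub>c ?Z) @\<^sub>r (Xt @\<^sub>c ?Y)) (r + j) = row (Xt @\<^sub>c ?Y) j"
      using j by (subst row_append_rows[OF U D]) auto
    ultimately show ?thesis
      unfolding eigvec_mat_def using j UD by (subst row_smult) auto
  qed
qed

text \<open>The argument is split in the same way as a row of the eigenvector matrix. The zero
  eigenvalues annihilate the middle part, which is where the entries of \<open>Xk\<close>
  sit.\<close>

lemma eigval_mat_mult_vec:
  assumes Lp: "Lp \<in> carrier_mat r r"
    and x: "x \<in> carrier_vec r" and y: "y \<in> carrier_vec (m - 2 * r)" and z: "z \<in> carrier_vec r"
  shows "eigval_mat m r Lp *\<^sub>v (x @\<^sub>v y @\<^sub>v z) =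
      (Lp *\<^sub>v x) @\<^sub>v 0\<^sub>v (m - 2 * r) @\<^sub>v - (Lp *\<^sub>v z)"
    and "eigval_mat m r Lp \<in> carrier_mat (r + (m - 2 * r + r)) (r + (m - 2 * r + r))"
proof -
  let ?k = "m - 2 * r"
  let ?D = "four_block_mat (0\<^sub>m ?k ?k) (0\<^sub>m ?k r) (0\<^sub>m r ?k) (- Lp)"
  \<comment> \<open>The recursion of \<open>diag_block_mat\<close> ends in an empty matrix; this
    equation removes that empty tail behind \<open>- Lp\<close>.\<close>
  have last: "four_block_mat (- Lp) (0\<^sub>m r 0) (0\<^sub>m 0 r) (0\<^sub>m 0 0) = - Lp"
    using Lp by (intro eq_matI) auto
  have eq: "eigval_mat m r Lp = four_block_mat Lp (0\<^sub>m r (?k + r)) (0\<^sub>m (?k + r) r) ?D"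
    using Lp last by (simp add: eigval_mat_def Let_def)
  show "eigval_mat m r Lp \<in> carrier_mat (r + (?k + r)) (r + (?k + r))"
    unfolding eq using Lp by auto
  have "(- Lp) *\<^sub>v z = - (Lp *\<^sub>v z)" using Lp z by simp
  then have D: "?D *\<^sub>v (y @\<^sub>v z) = 0\<^sub>v ?k @\<^sub>v - (Lp *\<^sub>v z)"
    using Lp y z by (subst mult_mat_vec_split) auto
  show "eigval_mat m r Lp *\<^sub>v (x @\<^sub>v y @\<^sub>v z) = (Lp *\<^sub>v x) @\<^sub>v 0\<^sub>v ?k @\<^sub>v - (Lp *\<^sub>v z)"
    unfolding eq D[symmetric] using Lp x y z by (intro mult_mat_vec_split) auto
qed

text \<open>In the entry \<open>(i, r + j)\<close> of the product the kernel block contributes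
  nothing, while the positive and negative eigenvalues contribute equally: the sign of
  \<open>- Lp\<close> cancels that of \<open>- Xt\<close>.\<close>

lemma eigendecomposition_block:
  assumes Ah: "Ah \<in> carrier_mat r (m - r)"
    and eig: "is_eigendecomposition m r Ah Xh Xt Xk Lp"
  shows "Ah = Xh * Lp * Xt\<^sup>T"
proof (rule eq_matI)
  have Lp: "Lp \<in> carrier_mat r r" and Xh: "Xh \<in> carrier_mat r r"
    and Xt: "Xt \<in> carrier_mat (m - r) r" and Xk: "Xk \<in> carrier_mat (m - r) (m - 2 * r)"
    and dec: "transport_mat m r Ah =
       eigvec_mat m r Xh Xt Xk * eigval_mat m r Lp * (eigvec_mat m r Xh Xt Xk)\<^sup>T"
    using eig unfolding is_eigendecomposition_def by auto
  let ?X = "eigvec_mat m r Xh Xt Xk" and ?E = "eigval_mat m r Lp"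
  let ?N = "r + (m - r)" and ?K = "r + (m - 2 * r + r)"
  have X: "?X \<in> carrier_mat ?N ?K" by (rule row_eigvec_mat(3)[OF Xh Xt Xk])
  \<comment> \<open>The zero vectors only discharge the vector assumptions that the carrier claim
    shares with the product formula.\<close>
  have E: "?E \<in> carrier_mat ?K ?K"
    by (rule eigval_mat_mult_vec(2)[OF Lp zero_carrier_vec zero_carrier_vec zero_carrier_vec])
  fix i j assume "i < dim_row (Xh * Lp * Xt\<^sup>T)" and "j < dim_col (Xh * Lp * Xt\<^sup>T)"
  then have i: "i < r" and j: "j < m - r" using Xh Xt by auto
  let ?x = "row Xh i" and ?t = "row Xt j" and ?s = "1 / sqrt 2 :: real"
  have x: "?x \<in> carrier_vec r" and t: "?t \<in> carrier_vec r"
    and k: "row Xk j \<in> carrier_vec (m - 2 * r)"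
    using Xh Xt Xk i j by auto
  have Lt: "Lp *\<^sub>v ?t \<in> carrier_vec r" using Lp t by simp
  have mL: "Lp *\<^sub>v (- ?t) = - (Lp *\<^sub>v ?t)"
    using Lp Xt by (intro eq_vecI) auto
  have Et: "?E *\<^sub>v (?t @\<^sub>v (sqrt 2 \<cdot>\<^sub>v row Xk j) @\<^sub>v - ?t) =
      (Lp *\<^sub>v ?t) @\<^sub>v 0\<^sub>v (m - 2 * r) @\<^sub>v (Lp *\<^sub>v ?t)"
    using eigval_mat_mult_vec(1)[OF Lp t, of "sqrt 2 \<cdot>\<^sub>v row Xk j" m "- ?t"] t k mL by simp
  have "Ah $$ (i, j) = transport_mat m r Ah $$ (i, r + j)"
    using Ah i j by (simp add: transport_mat_def)
  also have "\<dots> = (?X * (?E * ?X\<^sup>T)) $$ (i, r + j)"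
    unfolding dec using X E by (subst assoc_mult_mat) auto
  \<comment> \<open>Column \<open>r + j\<close> of \<open>?X\<^sup>T\<close> is row
    \<open>r + j\<close> of \<open>?X\<close>.\<close>
  also have "\<dots> = row ?X i \<bullet> (?E *\<^sub>v row ?X (r + j))"
    using X E i j by (simp add: mult_mat_vec_def col_mult2[of ?E ?K ?K "?X\<^sup>T" ?N])
  also have "\<dots> = ?s * (?s * ((?x @\<^sub>v 0\<^sub>v (m - 2 * r) @\<^sub>v ?x) \<bullet>
      ((Lp *\<^sub>v ?t) @\<^sub>v 0\<^sub>v (m - 2 * r) @\<^sub>v (Lp *\<^sub>v ?t))))"
  proof -
    have "?E *\<^sub>v row ?X (r + j) = ?s \<cdot>\<^sub>v ((Lp *\<^sub>v ?t) @\<^sub>v 0\<^sub>v (m - 2 * r) @\<^sub>v (Lp *\<^sub>v ?t))"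
      unfolding row_eigvec_mat(2)[OF Xh Xt Xk j] Et[symmetric]
      using t k by (intro mult_mat_vec[OF E]) auto
    moreover have "?x @\<^sub>v 0\<^sub>v (m - 2 * r) @\<^sub>v ?x \<in> carrier_vec ?K"
      "(Lp *\<^sub>v ?t) @\<^sub>v 0\<^sub>v (m - 2 * r) @\<^sub>v (Lp *\<^sub>v ?t) \<in> carrier_vec ?K"
      using x Lt by auto
    ultimately show ?thesis
      by (simp only: row_eigvec_mat(1)[OF Xh Xt Xk i] smult_carrier_vec
          smult_scalar_prod_distrib[of _ ?K] scalar_prod_smult_distrib[of _ ?K])
  qed
  also have "\<dots> = ?s * (?s * (?x \<bullet> (Lp *\<^sub>v ?t) + ?x \<bullet> (Lp *\<^sub>v ?t)))"
    using x Lt by (simp add: scalar_prod_append[of _ r _ "m - 2 * r + r"]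
        scalar_prod_append[of _ "m - 2 * r" _ r])
  \<comment> \<open>The two normalising factors \<open>1 / sqrt 2\<close> multiply to one half and
    cancel the doubling.\<close>
  also have "\<dots> = ?x \<bullet> (Lp *\<^sub>v ?t)" by (simp add: field_simps)
  also have "\<dots> = (Xh * (Lp * Xt\<^sup>T)) $$ (i, j)"
    using Xh Xt Lp i j by (simp add: mult_mat_vec_def col_mult2[of Lp r r "Xt\<^sup>T" "m - r"])
  finally show "Ah $$ (i, j) = (Xh * Lp * Xt\<^sup>T) $$ (i, j)"
    using Xh Xt Lp by (subst assoc_mult_mat) auto
next
  show "dim_row Ah = dim_row (Xh * Lp * Xt\<^sup>T)" "dim_col Ah = dim_col (Xh * Lp * Xt\<^sup>T)"
    using Ah eig unfolding is_eigendecomposition_def by auto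
qed

section \<open>Invertibility of the coefficient matrix\<close>

text \<open>Pairing a kernel equation with \<open>X *\<^sub>v (P *\<^sub>v v)\<close> instead of
  \<open>v\<close> is what exposes the quadratic forms of both \<open>L\<close> and
  \<open>P\<close>; their sum vanishes, so the positive definite one forces \<open>v\<close> to be
  zero.\<close>

lemma invertible_pos_semidef_plus_orthogonal:
  assumes L: "L \<in> carrier_mat r r" and psd: "pos_semidef L"
    and X: "X \<in> carrier_mat r r" and orth: "orthonormal_cols X"
    and P: "P \<in> carrier_mat r r" and pd: "pos_def P"
  shows "invertible_mat (L * X * P + X)"
proof (rule invertible_matI_kernel)
  show "L * X * P + X \<in> carrier_mat r r" using L X P by auto
  fix v assume v: "v \<in> carrier_vec r" and "(L * X * P + X) *\<^sub>v v = 0\<^sub>v r"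
  then have "L *\<^sub>v (X *\<^sub>v (P *\<^sub>v v)) + X *\<^sub>v v = 0\<^sub>v r"
    using L X P by (simp add: add_mult_distrib_mat_vec[of _ r r] assoc_mult_mat_vec[of _ r r _ r])
  moreover define w where "w = X *\<^sub>v (P *\<^sub>v v)"
  ultimately have eq: "L *\<^sub>v w + X *\<^sub>v v = 0\<^sub>v r" by simp
  have w: "w \<in> carrier_vec r" using X P v by (simp add: w_def)
  \<comment> \<open>Orthogonality gives
    \<open>X\<^sup>T *\<^sub>v w = P *\<^sub>v v\<close>.\<close>
  have "w \<bullet> (X *\<^sub>v v) = (P *\<^sub>v v) \<bullet> v"
  proof -
    have "w \<bullet> (X *\<^sub>v v) = (X\<^sup>T *\<^sub>v w) \<bullet> v"
      using transpose_vec_mult_scalar[OF X v w] by simp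
    then show ?thesis
      using orthonormal_cols_mult_vec[OF orth X, of "P *\<^sub>v v"] P v by (simp add: w_def)
  qed
  also have "\<dots> = v \<bullet> (P *\<^sub>v v)" using P v by (intro comm_scalar_prod) auto
  finally have "v \<bullet> (P *\<^sub>v v) = w \<bullet> (X *\<^sub>v v)" ..
  moreover have "w \<bullet> (L *\<^sub>v w) + w \<bullet> (X *\<^sub>v v) = 0"
    using arg_cong[OF eq, of "\<lambda>u. w \<bullet> u"] L X v w by (simp add: scalar_prod_add_distrib[of _ r])
  moreover have "0 \<le> w \<bullet> (L *\<^sub>v w)" using psd w L by (simp add: pos_semidef_def)
  ultimately have "\<not> 0 < v \<bullet> (P *\<^sub>v v)" by linarith
  then show "v = 0\<^sub>v r" using pd P v by (auto simp: pos_def_def)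
qed

section \<open>The boundary condition in characteristic variables\<close>

text \<open>Adding and subtracting the two halves decouples the block transform: the sum sees only
  \<open>up\<close>, the difference only \<open>um\<close>.\<close>

lemma characteristic_vars_eq_iff:
  assumes Xh: "Xh \<in> carrier_mat r r" and Xt: "Xt \<in> carrier_mat n r"
    and up: "up \<in> carrier_vec r" and um: "um \<in> carrier_vec n"
    and wp: "wp \<in> carrier_vec r" and wm: "wm \<in> carrier_vec r"
  shows "wp @\<^sub>v wm = characteristic_vars Xh Xt up um \<longleftrightarrow>
      wp + wm = sqrt 2 \<cdot>\<^sub>v (Xh\<^sup>T *\<^sub>v up) \<and> wp - wm = sqrt 2 \<cdot>\<^sub>v (Xt\<^sup>T *\<^sub>v um)"
proof -
  define a where "a = Xh\<^sup>T *\<^sub>v up"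
  define b where "b = Xt\<^sup>T *\<^sub>v um"
  have a: "a \<in> carrier_vec r" and b: "b \<in> carrier_vec r"
    using Xh Xt up um by (auto simp: a_def b_def)
  have neg: "- (Xt\<^sup>T) *\<^sub>v um = - b" using Xt um by (simp add: b_def)
  have "characteristic_vars Xh Xt up um =
      (1 / sqrt 2) \<cdot>\<^sub>v ((a + b) @\<^sub>v (a + - b))"
    unfolding characteristic_vars_def
    using Xh Xt up um neg
    by (subst four_block_mat_mult_vec[of _ r r _ n _ r]) (auto simp: a_def b_def)
  then have "wp @\<^sub>v wm = characteristic_vars Xh Xt up um \<longleftrightarrow>
      wp = (1 / sqrt 2) \<cdot>\<^sub>v (a + b) \<and> wm = (1 / sqrt 2) \<cdot>\<^sub>v (a + - b)"
    unfolding smult_append_vec using a b wp by (simp add: append_vec_eq[of _ r])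
  also have "\<dots> \<longleftrightarrow> (\<forall>i<r. wp $ i = (a $ i + b $ i) / sqrt 2 \<and> wm $ i = (a $ i - b $ i) / sqrt 2)"
    using a b wp wm by (auto simp: vec_eq_iff)
  also have "\<dots> \<longleftrightarrow> (\<forall>i<r. wp $ i + wm $ i = sqrt 2 * a $ i \<and> wp $ i - wm $ i = sqrt 2 * b $ i)"
  proof -
    have "p = (x + y) / sqrt 2 \<and> q = (x - y) / sqrt 2 \<longleftrightarrow>
        p + q = sqrt 2 * x \<and> p - q = sqrt 2 * y" for p q x y :: real
    proof -
      \<comment> \<open>Without division by \<open>sqrt 2\<close>, both sides are linear in
        \<open>p\<close>, \<open>q\<close>, \<open>sqrt 2 * x\<close> and
        \<open>sqrt 2 * y\<close>.\<close>
      have div: "z / sqrt 2 = sqrt 2 * z / 2" for z :: real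
      proof -
        have "sqrt 2 * z / 2 = (2 / sqrt 2) * z / 2" by (simp add: real_div_sqrt)
        then show ?thesis by simp
      qed
      show ?thesis unfolding div by (auto simp: algebra_simps)
    qed
    then show ?thesis by simp
  qed
  also have "\<dots> \<longleftrightarrow> wp + wm = sqrt 2 \<cdot>\<^sub>v a \<and> wp - wm = sqrt 2 \<cdot>\<^sub>v b"
    using a b wp wm by (auto simp: vec_eq_iff)
  finally show ?thesis unfolding a_def b_def .
qed

lemma onsager_bc_iff_characteristic:
  assumes Ah: "Ah \<in> carrier_mat r n" and dec: "Ah = Xh * Lp * Xt\<^sup>T"
    and L: "L \<in> carrier_mat r r" and g: "g \<in> carrier_vec r"
    and Lp: "Lp \<in> carrier_mat r r"
    and Xh: "Xh \<in> carrier_mat r r" and orth: "orthonormal_cols Xh"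
    and Xt: "Xt \<in> carrier_mat n r"
    and up: "up \<in> carrier_vec r" and um: "um \<in> carrier_vec n"
    and wp: "wp \<in> carrier_vec r" and wm: "wm \<in> carrier_vec r"
    and w: "wp @\<^sub>v wm = characteristic_vars Xh Xt up um"
  shows "onsager_bc L Ah g up um \<longleftrightarrow>
      (L * Xh * Lp + Xh) *\<^sub>v wm = (L * Xh * Lp - Xh) *\<^sub>v wp + sqrt 2 \<cdot>\<^sub>v g"
proof -
  let ?M = "L * Xh * Lp"
  have M: "?M \<in> carrier_mat r r" using L Xh Lp by simp
  have sum: "wp + wm = sqrt 2 \<cdot>\<^sub>v (Xh\<^sup>T *\<^sub>v up)"
    and diff: "wp - wm = sqrt 2 \<cdot>\<^sub>v (Xt\<^sup>T *\<^sub>v um)"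
    using w characteristic_vars_eq_iff[OF Xh Xt up um wp wm] by auto
  \<comment> \<open>Since \<open>Xh\<close> is square and orthogonal, applying it to the sum
    identity recovers \<open>up\<close> itself.\<close>
  have "Xh *\<^sub>v wp + Xh *\<^sub>v wm = Xh *\<^sub>v (sqrt 2 \<cdot>\<^sub>v (Xh\<^sup>T *\<^sub>v up))"
    using sum mult_add_distrib_mat_vec[OF Xh wp wm] by simp
  also have "\<dots> = sqrt 2 \<cdot>\<^sub>v (Xh *\<^sub>v (Xh\<^sup>T *\<^sub>v up))"
    using Xh up by (intro mult_mat_vec[OF Xh]) auto
  also have "\<dots> = sqrt 2 \<cdot>\<^sub>v up"
    by (simp add: orthonormal_cols_square_mult_vec[OF orth Xh up])
  finally have 1: "Xh *\<^sub>v wp + Xh *\<^sub>v wm = sqrt 2 \<cdot>\<^sub>v up" .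
  \<comment> \<open>The vector \<open>um\<close> cannot in general be recovered from
    \<open>Xt\<^sup>T *\<^sub>v um\<close>, but by the factorisation of \<open>Ah\<close> the
    boundary condition depends on \<open>um\<close> only through that product.\<close>
  have "L * Ah = ?M * Xt\<^sup>T"
    unfolding dec using L Xh Lp Xt
    by (simp add: assoc_mult_mat[of _ r r _ r _ n] assoc_mult_mat[of _ r r _ r _ r])
  then have LA: "(L * Ah) *\<^sub>v um = ?M *\<^sub>v (Xt\<^sup>T *\<^sub>v um)"
    using assoc_mult_mat_vec[OF M, of "Xt\<^sup>T" n um] Xt um by simp
  have "?M *\<^sub>v wp - ?M *\<^sub>v wm = ?M *\<^sub>v (sqrt 2 \<cdot>\<^sub>v (Xt\<^sup>T *\<^sub>v um))"
    using diff mult_minus_distrib_mat_vec[OF M wp wm] by simp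
  also have "\<dots> = sqrt 2 \<cdot>\<^sub>v ((L * Ah) *\<^sub>v um)"
    unfolding LA using Xt um by (intro mult_mat_vec[OF M]) auto
  finally have 2: "?M *\<^sub>v wp - ?M *\<^sub>v wm = sqrt 2 \<cdot>\<^sub>v ((L * Ah) *\<^sub>v um)" .
  \<comment> \<open>Naming the matrix-vector products keeps them opaque, so the rest is a
    coordinatewise linear rearrangement.\<close>
  define p q s t c where "p = ?M *\<^sub>v wp" and "q = ?M *\<^sub>v wm" and "s = Xh *\<^sub>v wp"
    and "t = Xh *\<^sub>v wm" and "c = (L * Ah) *\<^sub>v um"
  have car: "p \<in> carrier_vec r" "q \<in> carrier_vec r" "s \<in> carrier_vec r" "t \<in> carrier_vec r"
      "c \<in> carrier_vec r"
    using M Xh L Ah wp wm um by (auto simp: p_def q_def s_def t_def c_def)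
  have st: "s $ i + t $ i = sqrt 2 * up $ i" and pq: "p $ i - q $ i = sqrt 2 * c $ i"
    if "i < r" for i
    using arg_cong[OF 1[folded s_def t_def], of "\<lambda>v. v $ i"]
      arg_cong[OF 2[folded p_def q_def c_def], of "\<lambda>v. v $ i"] that car up by auto
  have "(?M + Xh) *\<^sub>v wm = (?M - Xh) *\<^sub>v wp + sqrt 2 \<cdot>\<^sub>v g \<longleftrightarrow>
      q + t = p - s + sqrt 2 \<cdot>\<^sub>v g"
    using add_mult_distrib_mat_vec[OF M Xh wm] minus_mult_distrib_mat_vec[OF M Xh wp]
    by (simp add: p_def q_def s_def t_def)
  also have "\<dots> \<longleftrightarrow> (\<forall>i<r. q $ i + t $ i = p $ i - s $ i + sqrt 2 * g $ i)"
    using car g by (auto simp: vec_eq_iff)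
  \<comment> \<open>Moving \<open>s\<close> to the left and \<open>q\<close> to the right leaves
    \<open>s + t\<close> and \<open>p - q\<close>, which the two identities evaluate.\<close>
  also have "\<dots> \<longleftrightarrow> (\<forall>i<r. sqrt 2 * up $ i = sqrt 2 * (c $ i + g $ i))"
    using st pq by (auto simp: algebra_simps)
  also have "\<dots> \<longleftrightarrow> up = c + g"
    using car g up by (auto simp: vec_eq_iff)
  finally show ?thesis unfolding onsager_bc_def c_def by simp
qed

section \<open>Unique determination of the incoming variables\<close>

text \<open>This supplies the existence half of unique solvability: a solution \<open>wm\<close> of
  the linear system must belong to an actual state. The witnesses invert the sum and difference
  identities, with \<open>Xh\<close> and \<open>Xt\<close> as right inverses of their
  transposes.\<close>

lemma characteristic_vars_surj:
  assumes Xh: "Xh \<in> carrier_mat r r" and oh: "orthonormal_cols Xh"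
    and Xt: "Xt \<in> carrier_mat n r" and ot: "orthonormal_cols Xt"
    and wp: "wp \<in> carrier_vec r" and wm: "wm \<in> carrier_vec r"
  obtains up um where "up \<in> carrier_vec r" "um \<in> carrier_vec n"
    "wp @\<^sub>v wm = characteristic_vars Xh Xt up um"
proof
  let ?a = "(1 / sqrt 2) \<cdot>\<^sub>v (wp + wm)" and ?b = "(1 / sqrt 2) \<cdot>\<^sub>v (wp - wm)"
  show up: "Xh *\<^sub>v ?a \<in> carrier_vec r" and um: "Xt *\<^sub>v ?b \<in> carrier_vec n"
    using wp wm by (intro mult_mat_vec_carrier[OF Xh] mult_mat_vec_carrier[OF Xt]; simp)+
  have "Xh\<^sup>T *\<^sub>v (Xh *\<^sub>v ?a) = ?a" "Xt\<^sup>T *\<^sub>v (Xt *\<^sub>v ?b) = ?b"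
    using wp wm
    by (auto intro!: orthonormal_cols_mult_vec[OF oh Xh] orthonormal_cols_mult_vec[OF ot Xt])
  then show "wp @\<^sub>v wm = characteristic_vars Xh Xt (Xh *\<^sub>v ?a) (Xt *\<^sub>v ?b)"
    unfolding characteristic_vars_eq_iff[OF Xh Xt up um wp wm]
    by (auto simp: smult_smult_assoc)
qed

theorem theorem7:
  fixes m r :: nat
    and Ah L Xh Xt Xk Lp :: "real mat"
    and g :: "real vec"
  assumes "r \<le> m - r"
    and "Ah \<in> carrier_mat r (m - r)"
    and "vec_space.rank r Ah = r"
    and "L \<in> carrier_mat r r" and "symmetric_mat L" and "pos_semidef L"
    and "g \<in> (\<lambda>x. L *\<^sub>v x) ` carrier_vec r"
    and "is_eigendecomposition m r Ah Xh Xt Xk Lp"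
  shows "(\<forall>up \<in> carrier_vec r. \<forall>um \<in> carrier_vec (m - r).
           \<forall>wp \<in> carrier_vec r. \<forall>wm \<in> carrier_vec r.
             wp @\<^sub>v wm = characteristic_vars Xh Xt up um \<longrightarrow>
             (onsager_bc L Ah g up um \<longleftrightarrow>
              (L * Xh * Lp + Xh) *\<^sub>v wm = (L * Xh * Lp - Xh) *\<^sub>v wp + sqrt 2 \<cdot>\<^sub>v g)) \<and>
         invertible_mat (L * Xh * Lp + Xh) \<and>
         (\<forall>wp \<in> carrier_vec r. \<exists>!wm. wm \<in> carrier_vec r \<and>
           (\<exists>up \<in> carrier_vec r. \<exists>um \<in> carrier_vec (m - r).
              wp @\<^sub>v wm = characteristic_vars Xh Xt up um \<and> onsager_bc L Ah g up um))"
proof -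
  have Lp: "Lp \<in> carrier_mat r r" "pos_def Lp" and Xh: "Xh \<in> carrier_mat r r"
    and oh: "orthonormal_cols Xh" and Xt: "Xt \<in> carrier_mat (m - r) r"
    and ot: "orthonormal_cols Xt"
    using assms(8) unfolding is_eigendecomposition_def by auto
  have g: "g \<in> carrier_vec r" using assms(4,7) by auto
  note dec = eigendecomposition_block[OF assms(2,8)]
  note equiv = onsager_bc_iff_characteristic[OF assms(2) dec assms(4) g Lp(1) Xh oh Xt]
  have inv: "invertible_mat (L * Xh * Lp + Xh)"
    by (rule invertible_pos_semidef_plus_orthogonal[OF assms(4,6) Xh oh Lp])
  have solve: "\<exists>!wm. wm \<in> carrier_vec r \<and>
      (\<exists>up \<in> carrier_vec r. \<exists>um \<in> carrier_vec (m - r).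
         wp @\<^sub>v wm = characteristic_vars Xh Xt up um \<and> onsager_bc L Ah g up um)"
    if wp: "wp \<in> carrier_vec r" for wp
  proof -
    let ?b = "(L * Xh * Lp - Xh) *\<^sub>v wp + sqrt 2 \<cdot>\<^sub>v g"
    \<comment> \<open>The state is eliminated: forwards by the equivalence for the given state,
      backwards by choosing a state that realises \<open>wp\<close> and \<open>wm\<close>. What
      remains is a linear system for \<open>wm\<close> alone.\<close>
    have "wm \<in> carrier_vec r \<and>
        (\<exists>up \<in> carrier_vec r. \<exists>um \<in> carrier_vec (m - r).
           wp @\<^sub>v wm = characteristic_vars Xh Xt up um \<and> onsager_bc L Ah g up um) \<longleftrightarrow>
        wm \<in> carrier_vec r \<and> (L * Xh * Lp + Xh) *\<^sub>v wm = ?b" for wm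
    proof (cases "wm \<in> carrier_vec r")
      case True
      then show ?thesis
        using equiv[OF _ _ wp True] characteristic_vars_surj[OF Xh oh Xt ot wp True] by metis
    qed simp
    moreover have "?b \<in> carrier_vec r"
      by (intro add_carrier_vec mult_mat_vec_carrier[OF minus_carrier_mat[OF Xh] wp]
          smult_carrier_vec[THEN iffD2] g)
    then have "\<exists>!wm. wm \<in> carrier_vec r \<and> (L * Xh * Lp + Xh) *\<^sub>v wm = ?b"
      by (rule invertible_mat_ex1[OF add_carrier_mat[OF Xh] inv])
    ultimately show ?thesis by (simp only:)
  qed
  show ?thesis
    by (intro conjI ballI impI equiv inv solve)
qed

end
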